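(* Let $G$ be a connected graph of order $n$ with maximum degree $\Delta(G)$, and let $M(G)$ be its middle graph. Then: (1) If $n\geq 3$, then $D(M(G))\leq \Delta(G)$; moreover this bound is sharp, i.e. there are connected graphs $G$ of order at least $3$ with $D(M(G))=\Delta(G)$. (2) $D'(M(G))\leq 3$ for every positive integer $n$.
   Context: All graphs are simple, finite, undirected. The middle graph $M(G)$ has vertex set $V(G)\cup E(G)$; a vertex $v\in V(G)$ is adjacent to an element $e\in E(G)$ iff $v$ is an endpoint of $e$, two elements $e,e'\in E(G)$ are adjacent iff they share an endpoint in $G$, and no two vertices of $V(G)$ are adjacent (equivalently, $M(G)$ is obtained from the subdivision graph of $G$ by joining pairs of subdivision vertices lying on adjacent edges of $G$). The distinguishing number $D(H)$ (resp. distinguishing index $D'(H)$) of a graph $H$ is the least $d$ such that $H$ has a vertex coloring (resp. edge coloring), not necessarily proper, with $d$ colors that is preserved only by the identity automorphism, where an automorphism $\phi$ preserves a coloring $f$ if $f(\phi(x))=f(x)$ for every colored element $x$. *)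

theory Defs
  imports Main "HOL-Library.Extended_Nat"
begin

record 'a sgraph =
  verts :: "'a set"
  edges :: "'a set set"

definition simple_graph :: "'a sgraph \<Rightarrow> bool" where
  "simple_graph G \<longleftrightarrow> finite (verts G) \<and>
     (\<forall>e\<in>edges G. \<exists>u\<in>verts G. \<exists>v\<in>verts G. u \<noteq> v \<and> e = {u, v})"

definition adjacency :: "'a sgraph \<Rightarrow> ('a \<times> 'a) set" where
  "adjacency G = {(u, v). {u, v} \<in> edges G}"

text \<open>The empty graph is not counted as connected, so a connected graph has positive order.\<close>

definition connected_graph :: "'a sgraph \<Rightarrow> bool" where
  "connected_graph G \<longleftrightarrow> verts G \<noteq> {} \<and>
     (\<forall>u\<in>verts G. \<forall>v\<in>verts G. (u, v) \<in> (adjacency G)\<^sup>*)"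

definition degree :: "'a sgraph \<Rightarrow> 'a \<Rightarrow> nat" where
  "degree G v = card {e \<in> edges G. v \<in> e}"

definition max_degree :: "'a sgraph \<Rightarrow> nat" where
  "max_degree G = Max (degree G ` verts G)"

definition middle_graph :: "'a sgraph \<Rightarrow> ('a + 'a set) sgraph" where
  "middle_graph G = \<lparr>
     verts = verts G <+> edges G,
     edges = {{Inl v, Inr e} | v e. v \<in> verts G \<and> e \<in> edges G \<and> v \<in> e}
           \<union> {{Inr e, Inr e'} | e e'. e \<in> edges G \<and> e' \<in> edges G \<and> e \<noteq> e' \<and> e \<inter> e' \<noteq> {}} \<rparr>"

text \<open>
  Automorphisms are total functions of which only the values on the vertex set matter;
  accordingly, being the identity means fixing every vertex of the graph.
\<close>

definition automorphism :: "'a sgraph \<Rightarrow> ('a \<Rightarrow> 'a) \<Rightarrow> bool" where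
  "automorphism G \<phi> \<longleftrightarrow> bij_betw \<phi> (verts G) (verts G) \<and>
     (\<forall>u\<in>verts G. \<forall>v\<in>verts G. {\<phi> u, \<phi> v} \<in> edges G \<longleftrightarrow> {u, v} \<in> edges G)"

definition distinguishing_vertex_colouring :: "'a sgraph \<Rightarrow> nat \<Rightarrow> ('a \<Rightarrow> nat) \<Rightarrow> bool" where
  "distinguishing_vertex_colouring G d f \<longleftrightarrow>
     (\<forall>v\<in>verts G. f v < d) \<and>
     (\<forall>\<phi>. automorphism G \<phi> \<and> (\<forall>v\<in>verts G. f (\<phi> v) = f v) \<longrightarrow> (\<forall>v\<in>verts G. \<phi> v = v))"

definition distinguishing_edge_colouring :: "'a sgraph \<Rightarrow> nat \<Rightarrow> ('a set \<Rightarrow> nat) \<Rightarrow> bool" where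
  "distinguishing_edge_colouring G d f \<longleftrightarrow>
     (\<forall>e\<in>edges G. f e < d) \<and>
     (\<forall>\<phi>. automorphism G \<phi> \<and> (\<forall>e\<in>edges G. f (\<phi> ` e) = f e) \<longrightarrow> (\<forall>v\<in>verts G. \<phi> v = v))"

text \<open>
  The least number of colours is taken in \<open>enat\<close>, so that it is \<open>\<infinity>\<close> when no distinguishing
  colouring exists (for edges this happens, e.g., for the complete graph on two vertices);
  an upper bound therefore includes the existence of a distinguishing colouring.
\<close>

definition distinguishing_number :: "'a sgraph \<Rightarrow> enat" where
  "distinguishing_number G = Inf {enat d | d. \<exists>f. distinguishing_vertex_colouring G d f}"

definition distinguishing_index :: "'a sgraph \<Rightarrow> enat" where
  "distinguishing_index G = Inf {enat d | d. \<exists>f. distinguishing_edge_colouring G d f}"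

end

theory Submission
  imports Defs "HOL-Combinatorics.Transposition"
begin

text \<open>
  In \<open>M(G)\<close> the neighbours of a vertex of \<open>G\<close> form a clique, while those of an edge of \<open>G\<close> do not.
  Hence every automorphism of \<open>M(G)\<close> is induced by an automorphism of \<open>G\<close>.

  For (1), an edge \<open>rs\<close> is the only edge of \<open>G\<close> with colour 1, and its ends get the colours 0 and 1,
  so \<open>r\<close> is fixed. Every other vertex chooses a parent in the previous distance layer around \<open>r\<close>,
  and the at most \<open>\<Delta>(G)\<close> children of a vertex get pairwise different colours.

  For (2), \<open>M(G)\<close> is the edge-disjoint union of the cliques formed by a vertex \<open>v\<close> and the edges at
  \<open>v\<close>. In each of them colour 1 is given to a Hamiltonian path starting at \<open>v\<close>, so that an
  automorphism fixing \<open>v\<close> fixes the whole clique. The colour 2 is used once, in order to fix a root.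
\<close>

section \<open>Simple and connected graphs\<close>

lemma edge_endpoints:
  assumes "simple_graph G" "{u, v} \<in> edges G"
  shows "u \<noteq> v" "u \<in> verts G" "v \<in> verts G"
proof -
  obtain a b where "a \<in> verts G" "b \<in> verts G" "a \<noteq> b" "{u, v} = {a, b}"
    using assms unfolding simple_graph_def by metis
  then show "u \<noteq> v" "u \<in> verts G" "v \<in> verts G" by (auto simp: doubleton_eq_iff)
qed

lemma edge_obtain_other:
  assumes "simple_graph G" "e \<in> edges G" "u \<in> e"
  obtains v where "e = {u, v}" "u \<noteq> v" "u \<in> verts G" "v \<in> verts G"
proof -
  obtain a b where "a \<in> verts G" "b \<in> verts G" "a \<noteq> b" "e = {a, b}"
    using assms unfolding simple_graph_def by metis
  then show thesis using that[of a] that[of b] assms(3) by auto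
qed

lemma edge_subset_verts:
  assumes "simple_graph G" "e \<in> edges G" shows "e \<subseteq> verts G"
  using edge_obtain_other[OF assms] by auto

lemma finite_verts: "simple_graph G \<Longrightarrow> finite (verts G)"
  by (simp add: simple_graph_def)

lemma finite_edges:
  assumes "simple_graph G" shows "finite (edges G)"
proof (rule finite_subset)
  show "edges G \<subseteq> Pow (verts G)" using edge_subset_verts[OF assms] by blast
qed (simp add: finite_verts[OF assms])

lemma card_edge:
  assumes "simple_graph G" "e \<in> edges G" shows "card e = 2"
proof -
  obtain a b where "a \<noteq> b" "e = {a, b}"
    using assms unfolding simple_graph_def by metis
  then show ?thesis by simp
qed

lemma connected_graph_induct:
  assumes "connected_graph G" "r \<in> verts G" "w \<in> verts G" "P r"
    and step: "\<And>u v. P u \<Longrightarrow> {u, v} \<in> edges G \<Longrightarrow> P v"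
  shows "P w"
proof -
  have "(r, w) \<in> (adjacency G)\<^sup>*" using assms by (auto simp: connected_graph_def)
  then show ?thesis
    by (induction rule: rtrancl_induct) (use assms in \<open>auto simp: adjacency_def\<close>)
qed

text \<open>Degrees count edges, whereas colours are later handed out to neighbours; sending
  \<open>w\<close> to \<open>{v, w}\<close> identifies the two.\<close>

lemma card_neighbours:
  assumes "simple_graph G"
  shows "finite {w. {v, w} \<in> edges G}" "card {w. {v, w} \<in> edges G} = degree G v"
proof -
  have "{w. {v, w} \<in> edges G} \<subseteq> verts G" using edge_endpoints[OF assms] by blast
  then show "finite {w. {v, w} \<in> edges G}"
    using finite_verts[OF assms] finite_subset by blast
  have "bij_betw (\<lambda>w. {v, w}) {w. {v, w} \<in> edges G} {e \<in> edges G. v \<in> e}"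
    unfolding bij_betw_def inj_on_def
  proof (intro conjI ballI impI)
    show "(\<lambda>w. {v, w}) ` {w. {v, w} \<in> edges G} = {e \<in> edges G. v \<in> e}"
      using edge_obtain_other[OF assms] by (auto simp: image_iff) metis
  qed (auto simp: doubleton_eq_iff)
  then show "card {w. {v, w} \<in> edges G} = degree G v"
    unfolding degree_def by (rule bij_betw_same_card)
qed

lemma degree_le_max_degree:
  assumes "simple_graph G" "v \<in> verts G" shows "degree G v \<le> max_degree G"
  unfolding max_degree_def using assms finite_verts by (intro Max_ge) auto

lemma connected_graph_neighbour_ex:
  assumes "connected_graph G" "r \<in> verts G" "verts G \<noteq> {r}"
  obtains s where "{r, s} \<in> edges G"
proof (rule ccontr)
  assume "\<not> thesis"
  then have none: "\<And>s. {r, s} \<notin> edges G" using that by blast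
  have "w = r" if "w \<in> verts G" for w
    using assms(1,2) that by (rule connected_graph_induct) (use none in auto)
  then show False using assms by blast
qed

text \<open>Part (1) uses the colours 0 and 1, so both have to be within the bound. If no vertex had
  two neighbours, an edge \<open>{r, s}\<close> would be a whole component, and a connected graph
  would have only two vertices.\<close>

lemma max_degree_ge_2:
  assumes G: "simple_graph G" "connected_graph G" and n: "3 \<le> card (verts G)"
  shows "2 \<le> max_degree G"
proof (rule ccontr)
  assume small: "\<not> 2 \<le> max_degree G"
  have unique: "a = b" if "{v, a} \<in> edges G" "{v, b} \<in> edges G" for v a b
  proof (rule ccontr)
    assume "a \<noteq> b"
    then have "2 = card {a, b}" by simp
    also have "\<dots> \<le> degree G v"
      unfolding card_neighbours(2)[OF G(1), symmetric]
      using card_neighbours(1)[OF G(1), of v] that by (intro card_mono) auto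
    also have "\<dots> \<le> max_degree G"
      using degree_le_max_degree[OF G(1)] edge_endpoints[OF G(1) that(1)] by blast
    finally show False using small by simp
  qed
  obtain r where r: "r \<in> verts G" using G(2) by (auto simp: connected_graph_def)
  have "verts G \<noteq> {r}" using n by auto
  then obtain s where s: "{r, s} \<in> edges G" using connected_graph_neighbour_ex[OF G(2) r] by blast
  have "w \<in> {r, s}" if "w \<in> verts G" for w
    using G(2) r that
  proof (rule connected_graph_induct)
    fix u v assume "u \<in> {r, s}" "{u, v} \<in> edges G"
    then show "v \<in> {r, s}" using s unique by (metis insert_commute insert_iff singletonD)
  qed simp
  then have "card (verts G) \<le> card {r, s}" by (intro card_mono) auto
  also have "\<dots> \<le> 2" by (simp add: card_insert_if)
  finally show False using n by simp
qed

section \<open>Automorphisms of the middle graph\<close>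

lemma automorphism_image_edge:
  assumes "simple_graph G" "automorphism G \<psi>" "e \<in> edges G"
  shows "\<psi> ` e \<in> edges G"
proof -
  obtain u v where "u \<in> verts G" "v \<in> verts G" "u \<noteq> v" "e = {u, v}"
    using assms(1,3) unfolding simple_graph_def by metis
  then show ?thesis using assms(2,3) by (simp add: automorphism_def)
qed

lemma verts_middle_graph [simp]:
  "Inl v \<in> verts (middle_graph G) \<longleftrightarrow> v \<in> verts G"
  "Inr e \<in> verts (middle_graph G) \<longleftrightarrow> e \<in> edges G"
  by (auto simp: middle_graph_def)

lemma edges_middle_graph [simp]:
  "{Inl u, Inl v} \<notin> edges (middle_graph G)"
  "{Inl v, Inr e} \<in> edges (middle_graph G) \<longleftrightarrow> v \<in> verts G \<and> e \<in> edges G \<and> v \<in> e"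
  "{Inr e, Inl v} \<in> edges (middle_graph G) \<longleftrightarrow> v \<in> verts G \<and> e \<in> edges G \<and> v \<in> e"
  "{Inr e, Inr e'} \<in> edges (middle_graph G) \<longleftrightarrow>
     e \<in> edges G \<and> e' \<in> edges G \<and> e \<noteq> e' \<and> e \<inter> e' \<noteq> {}"
  by (auto simp: middle_graph_def doubleton_eq_iff)

text \<open>Once \<open>\<phi>\<close> is known to permute the edges of \<open>G\<close>, it
  permutes the vertices as well, and incidence determines the image of an edge from the images of
  its ends.\<close>

lemma middle_graph_automorphism_induced:
  assumes G: "simple_graph G" and \<phi>: "automorphism (middle_graph G) \<phi>"
  obtains \<psi> where "automorphism G \<psi>"
    "\<And>v. v \<in> verts G \<Longrightarrow> \<phi> (Inl v) = Inl (\<psi> v)"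
    "\<And>e. e \<in> edges G \<Longrightarrow> \<phi> (Inr e) = Inr (\<psi> ` e)"
proof -
  let ?M = "middle_graph G"
  have inj: "inj_on \<phi> (verts ?M)" and im: "\<And>x. x \<in> verts ?M \<Longrightarrow> \<phi> x \<in> verts ?M"
    using \<phi> by (auto simp: automorphism_def bij_betw_def)
  have adj: "{\<phi> x, \<phi> y} \<in> edges ?M \<longleftrightarrow> {x, y} \<in> edges ?M" if "x \<in> verts ?M" "y \<in> verts ?M" for x y
    using \<phi> that by (auto simp: automorphism_def)
  \<comment> \<open>The ends of \<open>e\<close> are two non-adjacent neighbours of
    \<open>Inr e\<close>. No \<open>Inl w\<close> has such a pair, because its neighbours are edges
    through \<open>w\<close>, which are pairwise adjacent.\<close>
  have Inr_Inr: "\<phi> ` Inr ` edges G \<subseteq> Inr ` edges G"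
  proof safe
    fix e assume e: "e \<in> edges G"
    then obtain u v where uv: "u \<in> verts G" "v \<in> verts G" "u \<noteq> v" "e = {u, v}"
      using G unfolding simple_graph_def by metis
    have a: "{\<phi> (Inr e), \<phi> (Inl u)} \<in> edges ?M" "{\<phi> (Inr e), \<phi> (Inl v)} \<in> edges ?M"
      "{\<phi> (Inl u), \<phi> (Inl v)} \<notin> edges ?M"
      using uv e adj by auto
    have b: "\<phi> (Inl u) \<noteq> \<phi> (Inl v)"
      using inj uv by (metis Inl_inject inj_onD verts_middle_graph(1))
    have "\<phi> (Inr e) \<in> verts ?M" using im e by simp
    then show "\<phi> (Inr e) \<in> Inr ` edges G"
    proof (cases "\<phi> (Inr e)")
      case (Inl w)
      then show ?thesis
        using a b by (cases "\<phi> (Inl u)"; cases "\<phi> (Inl v)") auto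
    qed auto
  qed
  \<comment> \<open>An injection of a finite set into itself is onto, so no edge is left over as the
    image of an \<open>Inl\<close> vertex.\<close>
  have surj: "\<phi> ` Inr ` edges G = Inr ` edges G"
    using Inr_Inr finite_edges[OF G] inj
    by (intro endo_inj_surj) (auto intro: inj_on_subset)
  define \<psi> where "\<psi> v = projl (\<phi> (Inl v))" for v
  have \<psi>: "\<phi> (Inl v) = Inl (\<psi> v)" if v: "v \<in> verts G" for v
  proof (cases "\<phi> (Inl v)")
    case (Inr e)
    then have "e \<in> edges G" using im[of "Inl v"] v by simp
    then obtain e' where "e' \<in> edges G" "Inr e = \<phi> (Inr e')" using surj by blast
    then have "Inr e' = (Inl v :: 'a + 'a set)"
      using inj_onD[OF inj, of "Inr e'" "Inl v"] Inr v by simp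
    then show ?thesis by simp
  qed (simp add: \<psi>_def)
  have \<psi>_in: "\<psi> v \<in> verts G" if "v \<in> verts G" for v
    using \<psi>[OF that] im[of "Inl v"] that by simp
  have \<psi>_inj: "inj_on \<psi> (verts G)"
  proof (rule inj_onI)
    fix u v assume "u \<in> verts G" "v \<in> verts G" "\<psi> u = \<psi> v"
    then have "(Inl u :: 'a + 'a set) = Inl v"
      using inj_onD[OF inj, of "Inl u" "Inl v"] \<psi> by simp
    then show "u = v" by simp
  qed
  \<comment> \<open>By incidence \<open>e'\<close> contains the images of both ends of
    \<open>e\<close>; as both sets have two elements, they coincide.\<close>
  have \<psi>_edge: "\<phi> (Inr e) = Inr (\<psi> ` e)" if e: "e \<in> edges G" for e
  proof -
    obtain e' where e': "e' \<in> edges G" "\<phi> (Inr e) = Inr e'" using Inr_Inr e by auto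
    have "\<psi> ` e \<subseteq> e'"
    proof safe
      fix v assume v: "v \<in> e"
      then have V: "v \<in> verts G" using edge_subset_verts[OF G e] by auto
      show "\<psi> v \<in> e'" using adj[of "Inl v" "Inr e"] e e' V v \<psi>[OF V] by simp
    qed
    moreover have "card (\<psi> ` e) = card e'"
      using card_edge[OF G] e e' \<psi>_inj edge_subset_verts[OF G e]
      by (metis card_image inj_on_subset)
    moreover have "finite e'" using card_edge[OF G e'(1)] by (metis card.infinite zero_neq_numeral)
    ultimately show ?thesis using e' card_subset_eq by metis
  qed
  have "automorphism G \<psi>"
    unfolding automorphism_def
  proof (intro conjI ballI iffI)
    have "\<psi> ` verts G = verts G"
      using \<psi>_in \<psi>_inj finite_verts[OF G] by (intro endo_inj_surj) auto
    then show "bij_betw \<psi> (verts G) (verts G)" using \<psi>_inj by (simp add: bij_betw_def)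
  next
    fix u v assume uv: "u \<in> verts G" "v \<in> verts G" and "{\<psi> u, \<psi> v} \<in> edges G"
    then obtain e where e: "e \<in> edges G" "Inr {\<psi> u, \<psi> v} = \<phi> (Inr e)" using surj by blast
    then have "\<psi> ` e = \<psi> ` {u, v}" using \<psi>_edge[OF e(1)] by simp
    then have "e = {u, v}"
      using inj_on_image_eq_iff[OF \<psi>_inj edge_subset_verts[OF G e(1)], of "{u, v}"] uv by simp
    then show "{u, v} \<in> edges G" using e by simp
  next
    fix u v assume "{u, v} \<in> edges G"
    then show "{\<psi> u, \<psi> v} \<in> edges G" using \<psi>_edge[of "{u, v}"] Inr_Inr by force
  qed
  then show thesis using that \<psi> \<psi>_edge by blast
qed

text \<open>Reduces both colouring arguments to the vertices of \<open>G\<close>: an edge is a set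
  of vertices, so it is fixed once they are.\<close>

lemma middle_graph_identity:
  assumes G: "simple_graph G"
    and V: "\<And>v. v \<in> verts G \<Longrightarrow> \<phi> (Inl v) = Inl (\<psi> v)"
    and E: "\<And>e. e \<in> edges G \<Longrightarrow> \<phi> (Inr e) = Inr (\<psi> ` e)"
    and id: "\<And>v. v \<in> verts G \<Longrightarrow> \<psi> v = v"
  shows "\<forall>x\<in>verts (middle_graph G). \<phi> x = x"
proof
  fix x assume x: "x \<in> verts (middle_graph G)"
  show "\<phi> x = x"
  proof (cases x)
    case (Inr e)
    then have e: "e \<in> edges G" using x by simp
    then have "\<psi> ` e = e" using id edge_subset_verts[OF G e] by (force simp: image_iff)
    then show ?thesis using Inr E[OF e] by simp
  qed (use x V id in auto)
qed

text \<open>Supplies symmetries of the middle graph for a lower bound. Incidence, equality and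
  intersection of edges survive because \<open>\<psi>\<close> is injective on the vertices.\<close>

lemma automorphism_middle_graph:
  assumes G: "simple_graph G" and \<psi>: "automorphism G \<psi>"
  shows "automorphism (middle_graph G) (map_sum \<psi> (image \<psi>))"
proof -
  let ?M = "middle_graph G" and ?\<phi> = "map_sum \<psi> (image \<psi>)"
  have inj: "inj_on \<psi> (verts G)" and im: "\<And>v. v \<in> verts G \<Longrightarrow> \<psi> v \<in> verts G"
    using \<psi> by (auto simp: automorphism_def bij_betw_def)
  note sub = edge_subset_verts[OF G]
  note edge = automorphism_image_edge[OF G \<psi>]
  have image_eq: "\<psi> ` e = \<psi> ` e' \<longleftrightarrow> e = e'" if "e \<in> edges G" "e' \<in> edges G" for e e'
    by (rule inj_on_image_eq_iff[OF inj sub sub, OF that])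
  have mem: "\<psi> v \<in> \<psi> ` e \<longleftrightarrow> v \<in> e" if "v \<in> verts G" "e \<in> edges G" for v e
    by (rule inj_on_image_mem_iff[OF inj that(1) sub, OF that(2)])
  have meet: "\<psi> ` e \<inter> \<psi> ` e' \<noteq> {} \<longleftrightarrow> e \<inter> e' \<noteq> {}" if "e \<in> edges G" "e' \<in> edges G" for e e'
    using inj_on_image_Int[OF inj sub sub, OF that] by auto
  have fin: "finite (verts ?M)"
    using finite_verts[OF G] finite_edges[OF G] by (simp add: middle_graph_def)
  have "inj_on ?\<phi> (verts ?M)"
  proof (rule inj_onI)
    fix x y assume "x \<in> verts ?M" "y \<in> verts ?M" "?\<phi> x = ?\<phi> y"
    then show "x = y"
      by (cases x; cases y) (auto simp: image_eq dest: inj_onD[OF inj])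
  qed
  moreover have "?\<phi> ` verts ?M \<subseteq> verts ?M"
  proof safe
    fix x assume "x \<in> verts ?M"
    then show "?\<phi> x \<in> verts ?M" by (cases x) (auto simp: im edge)
  qed
  ultimately have "bij_betw ?\<phi> (verts ?M) (verts ?M)"
    using fin by (simp add: bij_betw_def endo_inj_surj)
  moreover have "{?\<phi> x, ?\<phi> y} \<in> edges ?M \<longleftrightarrow> {x, y} \<in> edges ?M"
    if "x \<in> verts ?M" "y \<in> verts ?M" for x y
    using that by (cases x; cases y) (simp_all add: im edge mem image_eq meet)
  ultimately show ?thesis by (simp add: automorphism_def)
qed

section \<open>The distinguishing number\<close>

lemma distinguishing_number_middle_graph_le:
  assumes G: "simple_graph G" "connected_graph G" and n: "3 \<le> card (verts G)"
  shows "distinguishing_number (middle_graph G) \<le> enat (max_degree G)"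
proof -
  let ?\<Delta> = "max_degree G"
  have \<Delta>: "2 \<le> ?\<Delta>" using max_degree_ge_2[OF G n] .
  obtain r where r: "r \<in> verts G" using G(2) by (auto simp: connected_graph_def)
  have "verts G \<noteq> {r}" using n by auto
  then obtain s where s: "{r, s} \<in> edges G" using connected_graph_neighbour_ex[OF G(2) r] by blast
  have rs: "r \<noteq> s" "s \<in> verts G" using edge_endpoints[OF G(1) s] by auto
  \<comment> \<open>The values of \<open>h\<close> are the colours that \<open>v\<close> hands out;
    labelling all neighbours covers whichever of them become children. Demanding 1 for
    \<open>s\<close> at \<open>r\<close> later separates the ends of \<open>{r, s}\<close>.\<close>
  have "\<exists>h. inj_on h {w. {v, w} \<in> edges G} \<and> h ` {w. {v, w} \<in> edges G} \<subseteq> {..<?\<Delta>} \<and>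
          (v = r \<longrightarrow> h s = 1)" if v: "v \<in> verts G" for v
  proof -
    let ?N = "{w. {v, w} \<in> edges G}"
    have "card ?N \<le> card {..<?\<Delta>}"
      using card_neighbours(2)[OF G(1)] degree_le_max_degree[OF G(1) v] by simp
    then obtain h where h: "inj_on h ?N" "h ` ?N \<subseteq> {..<?\<Delta>}"
      using card_le_inj[of ?N "{..<?\<Delta>}"] card_neighbours(1)[OF G(1)] by auto
    show ?thesis
    proof (cases "v = r")
      case True
      \<comment> \<open>Exchanging the values \<open>h s\<close> and 1 keeps the labels distinct and
        in range, as both values are below \<open>?\<Delta>\<close>.\<close>
      let ?h = "transpose (h s) 1 \<circ> h"
      have "h s < ?\<Delta>" using h s True by auto
      then have "?h ` ?N \<subseteq> {..<?\<Delta>}" using h(2) \<Delta> by (auto simp: transpose_def)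
      moreover have "inj_on ?h ?N" using h(1) by (intro comp_inj_on) auto
      ultimately show ?thesis by (intro exI[of _ ?h]) simp
    qed (use h in auto)
  qed
  then obtain g where g: "\<And>v. v \<in> verts G \<Longrightarrow> inj_on (g v) {w. {v, w} \<in> edges G}"
    "\<And>v. v \<in> verts G \<Longrightarrow> g v ` {w. {v, w} \<in> edges G} \<subseteq> {..<?\<Delta>}" "g r s = 1"
    using r by metis
  \<comment> \<open>\<open>S k\<close> is the ball of radius \<open>k\<close> around
    \<open>r\<close>, obtained by adding all neighbours \<open>k\<close> times.\<close>
  define S where "S k = ((\<lambda>A. A \<union> {w. \<exists>u\<in>A. {u, w} \<in> edges G}) ^^ k) {r}" for k :: nat
  have S_0: "S 0 = {r}" by (simp add: S_def)
  have S_Suc: "S (Suc k) = S k \<union> {w. \<exists>u\<in>S k. {u, w} \<in> edges G}" for k by (simp add: S_def)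
  have S_mono: "S j \<subseteq> S k" if "j \<le> k" for j k
    using lift_Suc_mono_le[of S, OF _ that] S_Suc by blast
  have S_all: "\<exists>k. w \<in> S k" if "w \<in> verts G" for w
    using G(2) r that
  proof (rule connected_graph_induct)
    show "\<exists>k. r \<in> S k" using S_0 by blast
    show "\<exists>k. v \<in> S k" if "\<exists>k. u \<in> S k" "{u, v} \<in> edges G" for u v using that S_Suc by blast
  qed
  \<comment> \<open>For \<open>w\<close> other than \<open>r\<close> this is the distance from
    \<open>r\<close> minus one, that is, the radius of the ball that contains the parent.\<close>
  define level where "level w = (LEAST k. w \<in> S (Suc k))" for w
  have level_eq: "level w = k" if "w \<in> S (Suc k)" "w \<notin> S k" for w k
    unfolding level_def
  proof (rule Least_equality)
    show "k \<le> j" if "w \<in> S (Suc j)" for j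
      using that \<open>w \<notin> S k\<close> S_mono[of "Suc j" k] by force
  qed fact
  have level_ex: "\<exists>k. w \<in> S (Suc k) \<and> w \<notin> S k" if w: "w \<in> verts G" "w \<noteq> r" for w
  proof -
    obtain k where "w \<in> S k" using S_all w by blast
    then show ?thesis by (induction k) (use w S_0 in auto)
  qed
  \<comment> \<open>The choice depends only on the set of candidates, and this set is invariant under
    automorphisms that fix the preceding layers.\<close>
  define parent where "parent w = (SOME u. u \<in> S (level w) \<and> {u, w} \<in> edges G)" for w
  have parent: "parent w \<in> S k" "{parent w, w} \<in> edges G" "parent w \<in> verts G"
    if "w \<in> S (Suc k)" "w \<notin> S k" for w k
  proof -
    have "\<exists>u. u \<in> S k \<and> {u, w} \<in> edges G" using that S_Suc by blast
    then have "parent w \<in> S k \<and> {parent w, w} \<in> edges G"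
      unfolding parent_def level_eq[OF that] by (rule someI_ex)
    then show "parent w \<in> S k" "{parent w, w} \<in> edges G" "parent w \<in> verts G"
      using edge_endpoints[OF G(1)] by auto
  qed
  \<comment> \<open>The root has no parent and takes 0, which keeps it apart from \<open>s\<close>:
    this is a child of \<open>r\<close> and gets \<open>g r s = 1\<close>.\<close>
  define f where "f w = (if w = r then 0 else g (parent w) w)" for w
  define F where "F x = (case x of Inl w \<Rightarrow> f w | Inr e \<Rightarrow> if e = {r, s} then 1 else 0)" for x
  have "s \<in> S (Suc 0)" "s \<notin> S 0" using rs s S_0 S_Suc by auto
  then have f_s: "f s = 1" using parent[of s 0] S_0 rs g(3) by (simp add: f_def)
  have f_less: "f w < ?\<Delta>" if w: "w \<in> verts G" for w
  proof (cases "w = r")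
    case False
    then obtain k where "w \<in> S (Suc k)" "w \<notin> S k" using level_ex w by blast
    from parent[OF this] show ?thesis using g(2)[of "parent w"] False by (auto simp: f_def)
  qed (use \<Delta> in \<open>simp add: f_def\<close>)
  have "distinguishing_vertex_colouring (middle_graph G) ?\<Delta> F"
    unfolding distinguishing_vertex_colouring_def
  proof (intro conjI allI impI)
    show "\<forall>x\<in>verts (middle_graph G). F x < ?\<Delta>"
    proof
      show "F x < ?\<Delta>" if "x \<in> verts (middle_graph G)" for x
        using that f_less \<Delta> by (cases x) (auto simp: F_def)
    qed
  next
    fix \<phi> assume "automorphism (middle_graph G) \<phi> \<and>
      (\<forall>x\<in>verts (middle_graph G). F (\<phi> x) = F x)"
    then have \<phi>: "automorphism (middle_graph G) \<phi>"
      and F: "\<And>x. x \<in> verts (middle_graph G) \<Longrightarrow> F (\<phi> x) = F x" by auto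
    obtain \<psi> where \<psi>: "automorphism G \<psi>"
      and V: "\<And>v. v \<in> verts G \<Longrightarrow> \<phi> (Inl v) = Inl (\<psi> v)"
      and E: "\<And>e. e \<in> edges G \<Longrightarrow> \<phi> (Inr e) = Inr (\<psi> ` e)"
      using middle_graph_automorphism_induced[OF G(1) \<phi>] by blast
    have inj: "inj_on \<psi> (verts G)" and im: "\<And>v. v \<in> verts G \<Longrightarrow> \<psi> v \<in> verts G"
      and adj: "\<And>u v. u \<in> verts G \<Longrightarrow> v \<in> verts G \<Longrightarrow>
        {\<psi> u, \<psi> v} \<in> edges G \<longleftrightarrow> {u, v} \<in> edges G"
      using \<psi> by (auto simp: automorphism_def bij_betw_def)
    have f: "f (\<psi> v) = f v" if "v \<in> verts G" for v
      using F[of "Inl v"] V[OF that] that by (simp add: F_def)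
    \<comment> \<open>\<open>{r, s}\<close> is the only edge with colour 1, hence it is mapped to
      itself; its ends have different colours, hence they are not exchanged.\<close>
    have "\<psi> ` {r, s} = {r, s}"
      using F[of "Inr {r, s}"] E[OF s] s by (simp add: F_def split: if_splits)
    moreover have "\<psi> r \<noteq> s" using f[OF r] f_s by (auto simp: f_def)
    ultimately have \<psi>_r: "\<psi> r = r" by auto
    have fixed: "w \<in> verts G \<and> w \<in> S k \<Longrightarrow> \<psi> w = w" for w k
    proof (induction k arbitrary: w)
      case 0
      then show ?case using S_0 \<psi>_r by simp
    next
      case (Suc k)
      show ?case
      proof (cases "w \<in> S k")
        case False
        have w: "w \<in> verts G" "w \<in> S (Suc k)" using Suc by auto
        \<comment> \<open>By induction the vertices in \<open>S k\<close> are fixed, so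
          \<open>w\<close> and \<open>\<psi> w\<close> have the same neighbours there. A
          \<open>u\<close> that is not a vertex lies on no edge.\<close>
        have adj_S: "{u, \<psi> w} \<in> edges G \<longleftrightarrow> {u, w} \<in> edges G" if "u \<in> S k" for u
        proof (cases "u \<in> verts G")
          case True
          then show ?thesis using adj[of u w] Suc.IH[of u] that w by simp
        qed (use edge_endpoints[OF G(1)] in blast)
        \<comment> \<open>\<open>\<psi> w\<close> enters at the same layer as \<open>w\<close>: a
          neighbour in \<open>S k\<close> puts it into the next ball, and injectivity keeps it out
          of \<open>S k\<close>, whose vertices are their own images.\<close>
        have w': "\<psi> w \<in> S (Suc k)" using w False adj_S S_Suc by auto
        have "\<psi> w \<notin> S k"
        proof
          assume "\<psi> w \<in> S k"
          then have "\<psi> (\<psi> w) = \<psi> w" using Suc.IH im w by blast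
          then have "\<psi> w = w" using inj im w by (meson inj_onD)
          then show False using \<open>\<psi> w \<in> S k\<close> False by simp
        qed
        note w' = w' this
        have "parent (\<psi> w) = parent w"
          unfolding parent_def level_eq[OF w'] level_eq[OF w(2) False] using adj_S by metis
        moreover have "w \<noteq> r" "\<psi> w \<noteq> r" using False w'(2) S_mono[of 0 k] S_0 by auto
        \<comment> \<open>Both vertices are neighbours of the common parent, whose labelling is
          injective, so equal colours make them equal.\<close>
        ultimately have "g (parent w) (\<psi> w) = g (parent w) w"
          using f[OF w(1)] by (simp add: f_def)
        then show ?thesis
          using parent[OF w'] parent[OF w(2) False] \<open>parent (\<psi> w) = parent w\<close> g(1)
          by (metis (mono_tags, lifting) inj_onD mem_Collect_eq)
      qed (use Suc in blast)
    qed
    then have "\<psi> w = w" if "w \<in> verts G" for w using that S_all by blast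
    then show "\<forall>x\<in>verts (middle_graph G). \<phi> x = x"
      using middle_graph_identity[OF G(1) V E] by blast
  qed
  then show ?thesis unfolding distinguishing_number_def by (intro Inf_lower) blast
qed

text \<open>Sharpness is witnessed by the path 0 - 1 - 2 of maximum degree 2: its reflection induces
  a nontrivial symmetry of the middle graph, so one colour does not suffice.\<close>

lemma path3_distinguishing_number:
  defines "H \<equiv> \<lparr>verts = {0, 1, 2 :: nat}, edges = {{0, 1}, {1, 2}}\<rparr>"
  shows "simple_graph H" "connected_graph H" "card (verts H) = 3"
    "distinguishing_number (middle_graph H) = enat (max_degree H)"
proof -
  show simple: "simple_graph H" by (auto simp: simple_graph_def H_def)
  have adj: "(0, 1) \<in> adjacency H" "(1, 0) \<in> adjacency H" "(1, 2) \<in> adjacency H"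
    "(2, 1) \<in> adjacency H"
    by (auto simp: adjacency_def H_def)
  have "(0, 2) \<in> (adjacency H)\<^sup>*" "(2, 0) \<in> (adjacency H)\<^sup>*"
    using adj by (meson r_into_rtrancl rtrancl_into_rtrancl)+
  then show connected: "connected_graph H"
    using adj by (auto simp: connected_graph_def H_def)
  show card: "card (verts H) = 3" by (simp add: H_def)
  have "{e \<in> edges H. 0 \<in> e} = {{0, 1}}" "{e \<in> edges H. 1 \<in> e} = {{0, 1}, {1, 2}}"
    "{e \<in> edges H. 2 \<in> e} = {{1, 2}}"
    by (auto simp: H_def)
  then have "degree H 0 = 1" "degree H 1 = 2" "degree H 2 = 1"
    by (simp_all add: degree_def doubleton_eq_iff)
  then have \<Delta>: "max_degree H = 2" by (simp add: max_degree_def H_def)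
  have "enat 2 \<le> enat d" if f: "distinguishing_vertex_colouring (middle_graph H) d f" for d f
  proof (rule ccontr)
    assume "\<not> enat 2 \<le> enat d"
    \<comment> \<open>With fewer than two colours the colouring is constant, so every automorphism
      preserves it.\<close>
    then have zero: "f x = 0" if "x \<in> verts (middle_graph H)" for x
      using f that by (fastforce simp: distinguishing_vertex_colouring_def)
    let ?\<psi> = "transpose 0 2 :: nat \<Rightarrow> nat"
    have "automorphism H ?\<psi>"
      unfolding automorphism_def
    proof
      show "bij_betw ?\<psi> (verts H) (verts H)"
        by (auto simp: bij_betw_def H_def inj_on_def transpose_def)
      show "\<forall>u\<in>verts H. \<forall>v\<in>verts H. {?\<psi> u, ?\<psi> v} \<in> edges H \<longleftrightarrow> {u, v} \<in> edges H"
        by (auto simp: H_def transpose_def doubleton_eq_iff)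
    qed
    then have \<phi>: "automorphism (middle_graph H) (map_sum ?\<psi> (image ?\<psi>))"
      by (rule automorphism_middle_graph[OF simple])
    then have "f (map_sum ?\<psi> (image ?\<psi>) x) = f x" if "x \<in> verts (middle_graph H)" for x
      using zero that by (metis automorphism_def bij_betwE)
    then have "map_sum ?\<psi> (image ?\<psi>) (Inl 0) = Inl 0"
      using f \<phi> unfolding distinguishing_vertex_colouring_def
      by (metis H_def insertI1 select_convs(1) verts_middle_graph(1))
    then show False by simp
  qed
  then have "enat (max_degree H) \<le> distinguishing_number (middle_graph H)"
    unfolding distinguishing_number_def \<Delta> by (auto intro: Inf_greatest)
  then show "distinguishing_number (middle_graph H) = enat (max_degree H)"
    using distinguishing_number_middle_graph_le[OF simple connected] card by (simp add: antisym)
qed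

section \<open>The distinguishing index\<close>

lemma distinguishing_index_middle_graph_le:
  assumes G: "simple_graph G" "connected_graph G"
  shows "distinguishing_index (middle_graph G) \<le> 3"
proof -
  obtain r where r: "r \<in> verts G" using G(2) by (auto simp: connected_graph_def)
  let ?I = "\<lambda>v. {e \<in> edges G. v \<in> e}"
  \<comment> \<open>Listing the edges at \<open>v\<close> after \<open>Inl v\<close> in the order of
    this enumeration gives the Hamiltonian path of the clique at \<open>v\<close>; \<open>B\<close>
    below collects the edges of all these paths.\<close>
  have "\<exists>h. bij_betw h {..<degree G v} (?I v)" for v
    unfolding degree_def lessThan_atLeast0
    using finite_edges[OF G(1)] by (intro ex_bij_betw_nat_finite) simp
  then obtain en where en: "\<And>v. bij_betw (en v) {..<degree G v} (?I v)" by metis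
  have en_mem: "en v i \<in> edges G" "v \<in> en v i" if "i < degree G v" for v i
    using bij_betwE[OF en] that by blast+
  define B where "B = {{Inl v, Inr (en v 0)} | v. 0 < degree G v} \<union>
    {{Inr (en v i), Inr (en v (Suc i))} | v i. Suc i < degree G v}"
  have B_Inl: "e = en v 0" if "{Inl v, Inr e} \<in> B" for v e
    using that by (auto simp: B_def doubleton_eq_iff)
  \<comment> \<open>Two distinct edges share at most one vertex, so a path edge joining two edges at
    \<open>v\<close> belongs to the path of \<open>v\<close> and not to that of another
    vertex.\<close>
  have B_Inr: "\<exists>j. Suc j < degree G v \<and> {e, e'} = {en v j, en v (Suc j)}"
    if B: "{Inr e, Inr e'} \<in> B" and e: "e \<in> ?I v" "e' \<in> ?I v" "e \<noteq> e'" for v e e'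
  proof -
    obtain v' j where j: "Suc j < degree G v'"
      "{Inr e, Inr e'} = {Inr (en v' j), Inr (en v' (Suc j)) :: 'a + 'a set}"
      using B by (auto simp: B_def doubleton_eq_iff)
    then have ee: "{e, e'} = {en v' j, en v' (Suc j)}" by (auto simp: doubleton_eq_iff)
    then have v': "v' \<in> e" "v' \<in> e'"
      using en_mem[of j v'] en_mem[of "Suc j" v'] j(1) by (auto simp: doubleton_eq_iff)
    have "v' = v"
    proof (rule ccontr)
      assume "v' \<noteq> v"
      then have "e = {v, v'}" "e' = {v, v'}"
        using e v' edge_obtain_other[OF G(1), of e v] edge_obtain_other[OF G(1), of e' v] by blast+
      then show False using e by simp
    qed
    then show ?thesis using j ee by blast
  qed
  \<comment> \<open>The first edge of the path of \<open>r\<close> gets 2 in place of 1. If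
    \<open>r\<close> is isolated, \<open>en r 0\<close> is unspecified, but then \<open>G\<close> is
    a single vertex and its middle graph has no edges.\<close>
  define F where "F X = (if X = {Inl r, Inr (en r 0)} then 2 else if X \<in> B then 1 else 0 :: nat)" for X
  \<comment> \<open>The path argument asks only whether a colour is nonzero, so the edge with colour
    2 still counts as part of the path of \<open>r\<close>.\<close>
  have F_pos: "F X \<noteq> 0" if "X \<in> B" for X using that by (simp add: F_def)
  have F_Inl: "e = en v 0" if "F {Inl v, Inr e} \<noteq> 0" for v e
    using that B_Inl[of v e] by (auto simp: F_def doubleton_eq_iff split: if_splits)
  have F_Inr: "{Inr e, Inr e'} \<in> B" if "F {Inr e, Inr e'} \<noteq> 0" for e e'
    using that by (auto simp: F_def doubleton_eq_iff split: if_splits)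
  have "distinguishing_edge_colouring (middle_graph G) 3 F"
    unfolding distinguishing_edge_colouring_def
  proof (intro conjI allI impI)
    show "\<forall>e\<in>edges (middle_graph G). F e < 3" by (simp add: F_def)
  next
    fix \<phi> assume "automorphism (middle_graph G) \<phi> \<and>
      (\<forall>e\<in>edges (middle_graph G). F (\<phi> ` e) = F e)"
    then have \<phi>: "automorphism (middle_graph G) \<phi>"
      and F: "\<And>e. e \<in> edges (middle_graph G) \<Longrightarrow> F (\<phi> ` e) = F e" by auto
    obtain \<psi> where \<psi>: "automorphism G \<psi>"
      and V: "\<And>v. v \<in> verts G \<Longrightarrow> \<phi> (Inl v) = Inl (\<psi> v)"
      and E: "\<And>e. e \<in> edges G \<Longrightarrow> \<phi> (Inr e) = Inr (\<psi> ` e)"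
      using middle_graph_automorphism_induced[OF G(1) \<phi>] by blast
    have inj: "inj_on \<psi> (verts G)" and im: "\<And>v. v \<in> verts G \<Longrightarrow> \<psi> v \<in> verts G"
      using \<psi> by (auto simp: automorphism_def bij_betw_def)
    note \<psi>_edge = automorphism_image_edge[OF G(1) \<psi>]
    have \<psi>_edge_inj: "e = e'" if "\<psi> ` e = \<psi> ` e'" "e \<in> edges G" "e' \<in> edges G" for e e'
      using that inj edge_subset_verts[OF G(1)] by (metis inj_on_image_eq_iff)
    \<comment> \<open>The edge with colour 2 is unique, so it is mapped to itself, and
      \<open>Inl r\<close> is its only end that is a vertex of \<open>G\<close>.\<close>
    have \<psi>_r: "\<psi> r = r"
    proof (cases "verts G = {r}")
      case False
      then obtain s where "{r, s} \<in> edges G"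
        using connected_graph_neighbour_ex[OF G(2) r] by blast
      then have "card (?I r) \<noteq> 0" using finite_edges[OF G(1)] by auto
      then have "0 < degree G r" by (simp add: degree_def)
      note en0 = en_mem[OF this]
      then have "F (\<phi> ` {Inl r, Inr (en r 0)}) = F {Inl r, Inr (en r 0)}"
        using r by (intro F) simp
      then have "F (\<phi> ` {Inl r, Inr (en r 0)}) = 2" by (simp add: F_def)
      then have "{Inl (\<psi> r), Inr (\<psi> ` en r 0)} = {Inl r, Inr (en r 0)}"
        using V[OF r] E[OF en0(1)] by (auto simp: F_def split: if_splits)
      then show ?thesis by (auto simp: doubleton_eq_iff)
    qed (use im r in auto)
    \<comment> \<open>The path of \<open>v\<close> is followed from its fixed start. The induction
      is strong because the step looks two places back.\<close>
    have edges_fixed: "\<psi> ` en v i = en v i" if v: "v \<in> verts G" "\<psi> v = v" and "i < degree G v" for v i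
      using that(3)
    proof (induction i rule: less_induct)
      case (less i)
      show ?case
      proof (cases i)
        case 0
        let ?X = "{Inl v, Inr (en v 0)}"
        have "?X \<in> B" using less.prems 0 by (auto simp: B_def)
        moreover have "?X \<in> edges (middle_graph G)" using en_mem less.prems 0 v by simp
        ultimately have "F (\<phi> ` ?X) \<noteq> 0" using F F_pos by metis
        moreover have "\<phi> ` ?X = {Inl v, Inr (\<psi> ` en v 0)}"
          using V v E en_mem(1) less.prems 0 by simp
        ultimately show ?thesis using F_Inl[of v "\<psi> ` en v 0"] 0 by simp
      next
        case (Suc k)
        let ?X = "{Inr (en v k), Inr (en v i)}" and ?e = "\<psi> ` en v i"
        have k: "k < degree G v" "\<psi> ` en v k = en v k" using less Suc by auto
        note ik = en_mem[OF k(1)] en_mem[OF less.prems]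
        have ne: "en v k \<noteq> en v i"
          using bij_betw_imp_inj_on[OF en] k(1) less.prems Suc by (metis inj_onD lessThan_iff n_not_Suc_n)
        have "?X \<in> B" using less.prems Suc by (auto simp: B_def)
        moreover have "?X \<in> edges (middle_graph G)" using ik ne by auto
        ultimately have "F (\<phi> ` ?X) \<noteq> 0" using F F_pos by metis
        then have "F {Inr (en v k), Inr ?e} \<noteq> 0" using E ik k by simp
        then have inB: "{Inr (en v k), Inr ?e} \<in> B" by (rule F_Inr)
        have "v \<in> ?e" using ik v by (metis imageI)
        moreover have "?e \<noteq> en v k" using \<psi>_edge_inj ik k(2) ne by metis
        ultimately obtain j where j: "Suc j < degree G v" "{en v k, ?e} = {en v j, en v (Suc j)}"
          using B_Inr[OF inB, of v] ik \<psi>_edge by auto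
        \<comment> \<open>The image of \<open>en v i\<close> is a path neighbour of the fixed
          \<open>en v k\<close>: either the successor \<open>en v i\<close> itself or the
          predecessor. The latter is fixed already, and injectivity rules it out.\<close>
        from j(2) consider "en v k = en v j" "?e = en v (Suc j)"
          | "en v k = en v (Suc j)" "?e = en v j"
          by (auto simp: doubleton_eq_iff)
        then show ?thesis
        proof cases
          case 1
          then have "k = j" using bij_betw_imp_inj_on[OF en] k(1) j(1)
            by (metis inj_onD lessThan_iff Suc_lessD)
          then show ?thesis using 1 Suc by simp
        next
          case 2
          then have "k = Suc j" using bij_betw_imp_inj_on[OF en] k(1) j(1)
            by (metis inj_onD lessThan_iff)
          then have "\<psi> ` en v j = en v j" using less.IH[of j] Suc j(1) by simp
          then have "en v i = en v j" using 2 \<psi>_edge_inj ik en_mem j(1) by (metis Suc_lessD)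
          then have "i = j" using bij_betw_imp_inj_on[OF en] less.prems j(1)
            by (metis inj_onD lessThan_iff Suc_lessD)
          then show ?thesis using Suc \<open>k = Suc j\<close> by simp
        qed
      qed
    qed
    \<comment> \<open>A fixed vertex fixes every edge at it, and an edge fixed together with one end
      has its other end fixed too; connectedness spreads this from \<open>r\<close>.\<close>
    have "w \<in> verts G \<and> \<psi> w = w" if "w \<in> verts G" for w
      using G(2) r that
    proof (rule connected_graph_induct)
      show "r \<in> verts G \<and> \<psi> r = r" using r \<psi>_r by simp
      fix u v assume u: "u \<in> verts G \<and> \<psi> u = u" and uv: "{u, v} \<in> edges G"
      then have "{u, v} \<in> en u ` {..<degree G u}"
        using bij_betw_imp_surj_on[OF en] by blast
      then have "\<psi> ` {u, v} = {u, v}" using edges_fixed[of u] u by force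
      then show "v \<in> verts G \<and> \<psi> v = v"
        using u edge_endpoints[OF G(1) uv] by (force simp: doubleton_eq_iff)
    qed
    then show "\<forall>x\<in>verts (middle_graph G). \<phi> x = x"
      using middle_graph_identity[OF G(1) V E] by blast
  qed
  then show ?thesis
    unfolding distinguishing_index_def numeral_eq_enat by (intro Inf_lower) blast
qed

theorem theorem3p6:
  shows "(\<forall>G :: 'a sgraph. simple_graph G \<and> connected_graph G \<and> 3 \<le> card (verts G) \<longrightarrow>
            distinguishing_number (middle_graph G) \<le> enat (max_degree G)) \<and>
         (\<exists>H :: nat sgraph. simple_graph H \<and> connected_graph H \<and> 3 \<le> card (verts H) \<and>
            distinguishing_number (middle_graph H) = enat (max_degree H)) \<and>
         (\<forall>G :: 'a sgraph. simple_graph G \<and> connected_graph G \<longrightarrow>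
            distinguishing_index (middle_graph G) \<le> 3)"
proof (intro conjI allI impI)
  show "\<exists>H :: nat sgraph. simple_graph H \<and> connected_graph H \<and> 3 \<le> card (verts H) \<and>
      distinguishing_number (middle_graph H) = enat (max_degree H)"
    using path3_distinguishing_number by (intro exI conjI) (assumption | simp)+
qed (simp_all add: distinguishing_number_middle_graph_le distinguishing_index_middle_graph_le)

end
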